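(* Let $(X,\mathcal{B},\mu,T)$ be a measure-preserving dynamical system ($\mu$ a probability measure) and let $\mathcal{C}$ be a collection of measurable subsets of $X$. Suppose that $\mu$ is $\Sigma$-mixing with respect to $(T,\mathcal{C})$ and let $\{E_n\}_{n\in\mathbb{N}}$ be a sequence of subsets in $\mathcal{C}$. Then, for any given $\varepsilon>0$, $$R(x,N)=\Phi(N)+O\left(\Phi^{1/2}(N)\,(\log\Phi(N))^{3/2+\varepsilon}\right)$$ for $\mu$-almost all $x\in X$, where $$\Phi(N):=\sum_{n=1}^N\mu(E_n).$$
   Context: Counting function: $R(x,N):=\#\{1\le n\le N: T^n(x)\in E_n\}$. $\Sigma$-mixing: for $n\in\mathbb{N}$ let $$\phi(n):=\sup\left\{\left|\frac{\mu(E\cap T^{-n}F)}{\mu(F)}-\mu(E)\right| : E\in\mathcal{C},\ F\in\mathcal{C}\right\}$$ (the supremum being over $F$ with $\mu(F)>0$). The measure $\mu$ is $\Sigma$-mixing (summable-mixing) with respect to $(T,\mathcal{C})$ if $\sum_{n=1}^\infty\phi(n)$ converges. Convention: the implied constant in $O(\cdot)$ may depend on $x$ and $\varepsilon$ but not on $N$; in the error term $\log t$ is read as $\max\{1,\log t\}$. *)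

theory Defs
  imports "HOL-Probability.Probability"
begin

locale measure_preserving_system = prob_space M for M :: "'a measure" +
  fixes T :: "'a \<Rightarrow> 'a"
  assumes T_measurable: "T \<in> measurable M M"
    and T_preserves: "\<And>A. A \<in> sets M \<Longrightarrow> emeasure M (T -` A \<inter> space M) = emeasure M A"

(* The supremum is taken in ennreal, so that it is 0 (and not an unspecified real)
   when no member of the collection has positive measure. *)
definition mixing_coeff ::
    "'a measure \<Rightarrow> ('a \<Rightarrow> 'a) \<Rightarrow> 'a set set \<Rightarrow> nat \<Rightarrow> ennreal" where
  "mixing_coeff M T \<C> n =
     Sup {ennreal \<bar>measure M (E \<inter> ((T ^^ n) -` F \<inter> space M)) / measure M F - measure M E\<bar> | E F.
            E \<in> \<C> \<and> F \<in> \<C> \<and> measure M F > 0}"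

(* For a series of nonnegative terms, convergence is finiteness of its ennreal-valued sum;
   the shift by Suc starts the series at index 1. *)
definition summable_mixing :: "'a measure \<Rightarrow> ('a \<Rightarrow> 'a) \<Rightarrow> 'a set set \<Rightarrow> bool" where
  "summable_mixing M T \<C> \<longleftrightarrow> (\<Sum>n. mixing_coeff M T \<C> (Suc n)) < \<infinity>"

definition hit_count :: "('a \<Rightarrow> 'a) \<Rightarrow> (nat \<Rightarrow> 'a set) \<Rightarrow> 'a \<Rightarrow> nat \<Rightarrow> nat" where
  "hit_count T E x N = card {n \<in> {1..N}. (T ^^ n) x \<in> E n}"

definition measure_sum :: "'a measure \<Rightarrow> (nat \<Rightarrow> 'a set) \<Rightarrow> nat \<Rightarrow> real" where
  "measure_sum M E N = (\<Sum>n=1..N. measure M (E n))"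

end

theory Submission
  imports Defs
begin

text \<open>Mixing bounds the covariance of the events \<open>T\<^sup>m x \<in> E m\<close> and \<open>T\<^sup>n x \<in> E n\<close> (\<open>m < n\<close>) by
  \<open>\<phi> (n - m) * \<mu> (E n)\<close>, so by summability the variance of the count over a block of times is
  \<open>O(\<Phi>)\<close> of that block. If \<open>\<Phi>\<close> is unbounded, sample at the first times \<open>q j\<close> where
  \<open>\<Phi>\<close> reaches \<open>j\<close>: along these the centered count has increments of variance \<open>O(b - a)\<close>, and
  the Rademacher--Menshov dyadic argument gives the rate; between consecutive sampling times
  monotonicity of the count and of \<open>\<Phi>\<close> costs only \<open>O(1)\<close>. If \<open>\<Phi>\<close> is bounded, the
  Borel--Cantelli lemma suffices.\<close>

section \<open>Second moment of the centered count over a block of times\<close>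

text \<open>Expanding the square leaves covariances. The diagonal costs at most one
  \<open>prob (A n)\<close> per index. Each off-diagonal pair is charged to its later index
  \<open>n\<close>, where all earlier \<open>m\<close> together cost at most
  \<open>suminf \<phi> * prob (A n)\<close>; the factor 2 counts both orders of a pair.\<close>

lemma (in prob_space) second_moment_centered_count:
  fixes A :: "nat \<Rightarrow> 'a set" and \<phi> :: "nat \<Rightarrow> real"
  assumes I: "finite I" and A: "\<And>n. n \<in> I \<Longrightarrow> A n \<in> events"
    and \<phi>: "summable \<phi>" "\<And>k. \<phi> k \<ge> 0"
    and cov: "\<And>m n. m \<in> I \<Longrightarrow> n \<in> I \<Longrightarrow> m < n \<Longrightarrow>
      prob (A m \<inter> A n) \<le> prob (A m) * prob (A n) + \<phi> (n - m) * prob (A n)"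
  shows "(\<integral>\<^sup>+x. ennreal ((\<Sum>n\<in>I. indicator (A n) x - prob (A n))\<^sup>2) \<partial>M)
    \<le> ennreal ((1 + 2 * suminf \<phi>) * (\<Sum>n\<in>I. prob (A n)))"
proof -
  let ?f = "\<lambda>n x. indicator (A n) x - prob (A n)"
  let ?g = "\<lambda>m n x. indicator (A m \<inter> A n) x - prob (A n) * indicator (A m) x
      - prob (A m) * indicator (A n) x + prob (A m) * prob (A n)"
  define h where "h m n = (if m < n then \<phi> (n - m) * prob (A n) else 0)" for m n
  have square: "(\<Sum>n\<in>I. ?f n x)\<^sup>2 = (\<Sum>m\<in>I. \<Sum>n\<in>I. ?g m n x)" for x
    unfolding power2_eq_square sum_product
    by (intro sum.cong refl) (simp add: indicator_inter_arith algebra_simps)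
  have g_int: "integrable M (?g m n)" if "m \<in> I" "n \<in> I" for m n
    using A that by (auto intro!: integrable_real_indicator simp: emeasure_eq_measure)
  have g_val: "(\<integral>x. ?g m n x \<partial>M) = prob (A m \<inter> A n) - prob (A m) * prob (A n)"
    if "m \<in> I" "n \<in> I" for m n
    using A[OF that(1)] A[OF that(2)]
    by (simp add: emeasure_eq_measure prob_space integrable_real_indicator sets.Int)
  have g_le: "(\<integral>x. ?g m n x \<partial>M) \<le> h m n + h n m + (if m = n then prob (A n) else 0)"
    if "m \<in> I" "n \<in> I" for m n
    using that cov[of m n] cov[of n m] unfolding g_val[OF that] h_def
    by (cases m n rule: linorder_cases) (auto simp: Int_commute mult.commute)
  have h_sum: "(\<Sum>m\<in>I. h m n) \<le> suminf \<phi> * prob (A n)" for n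
  proof -
    have "(\<Sum>m\<in>I. h m n) = (\<Sum>m\<in>{m\<in>I. m < n}. \<phi> (n - m)) * prob (A n)"
      unfolding h_def sum_distrib_right using I by (simp add: sum.inter_filter)
    \<comment> \<open>Distinct \<open>m < n\<close> have distinct lags \<open>n - m\<close>, so no
      value of \<open>\<phi>\<close> is used twice and the total sum bounds the whole.\<close>
    also have "(\<Sum>m\<in>{m\<in>I. m < n}. \<phi> (n - m)) = sum \<phi> ((\<lambda>m. n - m) ` {m\<in>I. m < n})"
      by (subst sum.reindex) (auto simp: inj_on_def)
    also have "\<dots> \<le> suminf \<phi>"
      using I \<phi> by (intro sum_le_suminf) auto
    finally show ?thesis by (simp add: mult_right_mono)
  qed
  have "(\<integral>x. (\<Sum>n\<in>I. ?f n x)\<^sup>2 \<partial>M) = (\<Sum>m\<in>I. \<Sum>n\<in>I. (\<integral>x. ?g m n x \<partial>M))"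
    unfolding square by (simp add: g_int Bochner_Integration.integral_sum)
  also have "\<dots> \<le> (\<Sum>m\<in>I. \<Sum>n\<in>I. h m n + h n m + (if m = n then prob (A n) else 0))"
    by (intro sum_mono g_le)
  also have "\<dots> = (\<Sum>m\<in>I. \<Sum>n\<in>I. h m n) + (\<Sum>n\<in>I. \<Sum>m\<in>I. h m n) + (\<Sum>n\<in>I. prob (A n))"
    using I by (simp add: sum.distrib)
  also have "\<dots> = 2 * (\<Sum>n\<in>I. \<Sum>m\<in>I. h m n) + (\<Sum>n\<in>I. prob (A n))"
    by (subst (1) sum.swap) simp
  also have "\<dots> \<le> 2 * (\<Sum>n\<in>I. suminf \<phi> * prob (A n)) + (\<Sum>n\<in>I. prob (A n))"
    by (intro add_mono mult_left_mono sum_mono h_sum) auto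
  also have "\<dots> = (1 + 2 * suminf \<phi>) * (\<Sum>n\<in>I. prob (A n))"
    by (simp add: sum_distrib_left algebra_simps)
  finally have "(\<integral>x. (\<Sum>n\<in>I. ?f n x)\<^sup>2 \<partial>M) \<le> (1 + 2 * suminf \<phi>) * (\<Sum>n\<in>I. prob (A n))" .
  moreover have "integrable M (\<lambda>x. (\<Sum>n\<in>I. ?f n x)\<^sup>2)"
    unfolding square by (intro Bochner_Integration.integrable_sum g_int)
  ultimately show ?thesis
    by (subst nn_integral_eq_integral) (auto intro: ennreal_leI)
qed

section \<open>Dyadic decomposition and the Rademacher--Menshov argument\<close>

text \<open>Level \<open>s\<close> cuts the interval from 0 to \<open>2^r\<close> into consecutive
  blocks of length \<open>2^s\<close>. One quantity thus controls \<open>z j\<close> for every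
  \<open>j < 2^r\<close> at once, which makes a maximal inequality unnecessary.\<close>

definition dyadic_energy :: "(nat \<Rightarrow> real) \<Rightarrow> nat \<Rightarrow> real" where
  "dyadic_energy z r = (\<Sum>s<r. \<Sum>i<2^(r - s). (z (Suc i * 2^s) - z (i * 2^s))\<^sup>2)"

lemma dyadic_energy_nonneg: "dyadic_energy z r \<ge> 0"
  unfolding dyadic_energy_def by (intro sum_nonneg) auto

text \<open>Telescoping over the binary truncations of \<open>j\<close> writes \<open>z j - z 0\<close> as a sum of at most
  one dyadic increment per level; then Cauchy--Schwarz.\<close>

lemma square_le_dyadic_energy:
  fixes z :: "nat \<Rightarrow> real"
  assumes "z 0 = 0" "j < 2 ^ r"
  shows "(z j)\<^sup>2 \<le> real r * dyadic_energy z r"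
proof -
  \<comment> \<open>\<open>q s * 2 ^ s\<close> is \<open>j\<close> with its lowest \<open>s\<close>
    binary digits cleared: it is \<open>j\<close> at \<open>s = 0\<close> and 0 at
    \<open>s = r\<close>.\<close>
  define q where "q s = j div 2 ^ s" for s
  have q_Suc: "q (Suc s) = q s div 2" for s
    unfolding q_def power_Suc2 by (rule div_mult2_eq)
  define d where "d s = z (q s * 2 ^ s) - z (q (Suc s) * 2 ^ Suc s)" for s
  have "(\<Sum>s<r. d s) = z (q 0 * 2 ^ 0) - z (q r * 2 ^ r)"
    unfolding d_def by (rule sum_lessThan_telescope')
  then have z: "z j = (\<Sum>s<r. d s)"
    using assms by (simp add: q_def)
  have d: "(d s)\<^sup>2 \<le> (\<Sum>i<2^(r - s). (z (Suc i * 2^s) - z (i * 2^s))\<^sup>2)" if "s < r" for s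
  \<comment> \<open>Clearing digit \<open>s\<close> changes nothing if that digit is 0; if it is 1,
    it removes exactly one block of level \<open>s\<close>.\<close>
  proof (cases "even (q s)")
    case True
    then have "q (Suc s) * 2 ^ Suc s = q s * 2 ^ s"
      by (auto simp: q_Suc elim!: evenE)
    then have "d s = 0" unfolding d_def by (simp only: diff_self)
    then show ?thesis by (simp add: sum_nonneg)
  next
    case False
    then obtain k where k: "q s = Suc (2 * k)" by (auto elim!: oddE)
    have "q s < 2 ^ (r - s)"
      unfolding q_def using assms(2) that
      by (simp add: less_mult_imp_div_less flip: power_add)
    then have mem: "2 * k \<in> {..<2 ^ (r - s)}" using k by simp
    have "(d s)\<^sup>2 = (z (Suc (2 * k) * 2^s) - z (2 * k * 2^s))\<^sup>2"
      by (simp add: d_def q_Suc k mult.assoc mult.left_commute)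
    also have "\<dots> \<le> (\<Sum>i<2^(r - s). (z (Suc i * 2^s) - z (i * 2^s))\<^sup>2)"
      using member_le_sum[OF mem, of "\<lambda>i. (z (Suc i * 2^s) - z (i * 2^s))\<^sup>2"] by simp
    finally show ?thesis .
  qed
  have "(z j)\<^sup>2 \<le> real r * (\<Sum>s<r. (d s)\<^sup>2)"
    unfolding z using sum_squared_le_sum_of_squares[of d "{..<r}"] by (simp add: mult.commute)
  also have "\<dots> \<le> real r * dyadic_energy z r"
    unfolding dyadic_energy_def by (intro mult_left_mono sum_mono d) auto
  finally show ?thesis .
qed

text \<open>Chooses the level for a given \<open>t\<close>: every \<open>j \<le> 2 * t\<close> falls
  below \<open>2 ^ r\<close>, while the last two bounds translate \<open>2 ^ r\<close> and
  \<open>r\<close> back into \<open>t\<close> and its logarithm.\<close>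

lemma exists_dyadic_level:
  fixes t :: real
  assumes "t \<ge> 1"
  obtains r :: nat where "r \<ge> 1" "2 * t < 2 ^ r" "2 ^ r \<le> 4 * t" "real r \<le> 4 * max 1 (ln t)"
proof -
  obtain n where "2 ^ n \<le> nat \<lfloor>2 * t\<rfloor>" "nat \<lfloor>2 * t\<rfloor> < 2 ^ (n + 1)"
    using ex_power_ivl1[of 2 "nat \<lfloor>2 * t\<rfloor>"] assms by (auto simp: le_nat_iff le_floor_iff)
  then have n: "2 ^ n \<le> 2 * t" "2 * t < 2 ^ Suc n"
    using assms by (simp_all add: le_nat_iff le_floor_iff nat_less_iff floor_less_iff)
  \<comment> \<open>This gives \<open>n \<le> 2 * ln t + 1\<close> for \<open>n \<ge> 1\<close>,
    hence \<open>Suc n \<le> 2 * ln t + 2\<close>, which explains the factor 4.\<close>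
  have ln2: "ln 2 > (1/2 :: real)"
    using ln_2_less_1 ln2_ge_two_thirds by simp
  have "ln (2 ^ n) \<le> ln (2 * t)" using n assms by (subst ln_le_cancel_iff) auto
  then have "real n * ln 2 \<le> ln 2 + ln t"
    using assms by (simp add: ln_realpow ln_mult)
  then have "(real n - 1) * ln 2 \<le> ln t" by (simp add: algebra_simps)
  moreover have "(real n - 1) * (1/2) \<le> (real n - 1) * ln 2" if "n \<ge> 1"
    using that ln2 by (intro mult_left_mono) auto
  ultimately have "real (Suc n) \<le> 4 * max 1 (ln t)" by (cases "n = 0") auto
  then show ?thesis using that[of "Suc n"] n by simp
qed

text \<open>Only the logarithm is truncated: the rate still vanishes at \<open>t = 0\<close> and is
  small for small \<open>t\<close>, so small values need the separate treatment below.\<close>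

definition error_rate :: "real \<Rightarrow> real \<Rightarrow> real" where
  "error_rate \<epsilon> t = t powr (1/2) * max 1 (ln t) powr (3/2 + \<epsilon>)"

lemma error_rate_ge_1:
  assumes "t \<ge> 1" "\<epsilon> > 0"
  shows "error_rate \<epsilon> t \<ge> 1"
  using mult_mono[of 1 "t powr (1/2)" 1 "max 1 (ln t) powr (3/2 + \<epsilon>)"] assms
  by (simp add: error_rate_def ge_one_powr_ge_zero)

text \<open>Lets the truncation \<open>max 1 t\<close> be dropped at the price of a constant. For
  \<open>t < 1\<close> both logarithmic factors are 1, and \<open>t powr (1/2)\<close> is at least
  \<open>\<delta> powr (1/2)\<close>.\<close>

lemma error_rate_max_1_le:
  assumes "0 < \<delta>" "\<delta> \<le> t"
  shows "error_rate \<epsilon> (max 1 t) \<le> max 1 (\<delta> powr (-1/2)) * error_rate \<epsilon> t"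
proof (cases "t \<ge> 1")
  case True
  then have "1 * error_rate \<epsilon> t \<le> max 1 (\<delta> powr (-1/2)) * error_rate \<epsilon> t"
    by (intro mult_right_mono) (auto simp: error_rate_def)
  then show ?thesis using True by (simp add: max_def)
next
  case False
  then have ln: "ln t \<le> 1" using assms ln_le_minus_one[of t] by linarith
  have "1 = \<delta> powr (-1/2) * \<delta> powr (1/2)"
    using assms by (simp flip: powr_add)
  also have "\<dots> \<le> max 1 (\<delta> powr (-1/2)) * t powr (1/2)"
    using assms by (intro mult_mono powr_mono2) auto
  finally have "1 \<le> max 1 (\<delta> powr (-1/2)) * t powr (1/2)" .
  moreover have "max 1 t = 1" "max 1 (ln t) = 1" using False ln by auto
  ultimately show ?thesis unfolding error_rate_def by simp
qed

text \<open>The Rademacher--Menshov method. Rather than along all \<open>j\<close>, the bound is stated for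
  \<open>j \<le> 2 * t\<close> with real \<open>t\<close>, which absorbs the rounding of \<open>\<Phi> N\<close> to an integer.\<close>

lemma AE_bound_of_linear_second_moment:
  fixes Z :: "nat \<Rightarrow> 'a \<Rightarrow> real"
  assumes meas: "\<And>j. Z j \<in> borel_measurable M"
    and zero: "\<And>x. Z 0 x = 0"
    and moment: "\<And>a b. a \<le> b \<Longrightarrow>
      (\<integral>\<^sup>+x. ennreal ((Z b x - Z a x)\<^sup>2) \<partial>M) \<le> ennreal (C * (real b - real a))"
    and "C \<ge> 0" "\<epsilon> > 0"
  shows "AE x in M. \<exists>K. \<forall>t\<ge>1. \<forall>j. real j \<le> 2 * t \<longrightarrow>
    \<bar>Z j x\<bar> \<le> K * error_rate \<epsilon> t"
proof -
  \<comment> \<open>The mean of \<open>G r\<close> is at most \<open>C * r * 2 ^ r\<close>, so the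
    mean of \<open>G r / w r\<close> is \<open>O(r powr (-1 - 2 * \<epsilon>))\<close>, which is
    summable. The final bound \<open>r * w r\<close> carries
    \<open>r powr (3 + 2 * \<epsilon>)\<close>, whose square root has the exponent
    \<open>3/2 + \<epsilon>\<close>.\<close>
  define w where "w r = 2 ^ r * real r powr (2 + 2 * \<epsilon>)" for r :: nat
  define G where "G r x = dyadic_energy (\<lambda>j. Z j x) r" for r x
  have w_pos: "w r > 0" if "r \<ge> 1" for r using that by (simp add: w_def)
  note meas[measurable]
  have G_meas[measurable]: "G r \<in> borel_measurable M" for r
    unfolding G_def dyadic_energy_def by measurable
  have G_int: "(\<integral>\<^sup>+x. ennreal (G r x) \<partial>M) \<le> ennreal (C * real r * 2 ^ r)" for r
  proof -
    have "(\<integral>\<^sup>+x. ennreal (G r x) \<partial>M) =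
       (\<Sum>s<r. \<Sum>i<2^(r - s). \<integral>\<^sup>+x. ennreal ((Z (Suc i * 2^s) x - Z (i * 2^s) x)\<^sup>2) \<partial>M)"
      unfolding G_def dyadic_energy_def
      by (simp add: sum_nonneg nn_integral_sum flip: sum_ennreal del: mult_Suc)
    also have "\<dots> \<le> (\<Sum>s<r. \<Sum>i<(2::nat)^(r - s). ennreal (C * 2 ^ s))"
    proof (intro sum_mono)
      fix s i :: nat
      have "(\<integral>\<^sup>+x. ennreal ((Z (Suc i * 2^s) x - Z (i * 2^s) x)\<^sup>2) \<partial>M)
        \<le> ennreal (C * (real (Suc i * 2^s) - real (i * 2^s)))"
        by (rule moment) simp
      also have "real (Suc i * 2^s) - real (i * 2^s) = 2 ^ s" by (simp add: algebra_simps)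
      finally show "(\<integral>\<^sup>+x. ennreal ((Z (Suc i * 2^s) x - Z (i * 2^s) x)\<^sup>2) \<partial>M)
        \<le> ennreal (C * 2 ^ s)" .
    qed
    also have "\<dots> = ennreal (\<Sum>s<r. \<Sum>i<(2::nat)^(r - s). C * 2 ^ s)"
      using \<open>C \<ge> 0\<close> by (simp add: sum_nonneg del: sum_constant flip: sum_ennreal)
    \<comment> \<open>The blocks of each level have total length \<open>2 ^ r\<close>, so all
      \<open>r\<close> levels contribute equally.\<close>
    also have "(\<Sum>s<r. \<Sum>i<(2::nat)^(r - s). C * 2 ^ s) = (\<Sum>s<r. C * 2 ^ r)"
    proof (intro sum.cong refl)
      fix s assume "s \<in> {..<r}"
      then have "(2::real) ^ (r - s) * 2 ^ s = 2 ^ r" by (simp flip: power_add)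
      then show "(\<Sum>i<(2::nat)^(r - s). C * 2 ^ s) = C * 2 ^ r"
        by (simp add: mult.left_commute)
    qed
    also have "\<dots> = C * real r * 2 ^ r" by simp
    finally show ?thesis .
  qed
  \<comment> \<open>The series starts at level 1 because \<open>w 0 = 0\<close>. Its finite integral
    makes it finite almost everywhere, and its value \<open>H\<close> then bounds every single ratio
    \<open>G r x / w r\<close>.\<close>
  have "(\<integral>\<^sup>+x. (\<Sum>r. ennreal (G (Suc r) x / w (Suc r))) \<partial>M)
      = (\<Sum>r. \<integral>\<^sup>+x. ennreal (G (Suc r) x / w (Suc r)) \<partial>M)"
    by (intro nn_integral_suminf) measurable
  also have "\<dots> \<le> (\<Sum>r. ennreal (C * real (Suc r) powr (-1 - 2 * \<epsilon>)))"
  proof (intro suminf_le summableI)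
    fix r
    let ?r = "Suc r"
    have "(\<integral>\<^sup>+x. ennreal (G ?r x / w ?r) \<partial>M)
        = (\<integral>\<^sup>+x. ennreal (1 / w ?r) * ennreal (G ?r x) \<partial>M)"
      using w_pos[of ?r] by (simp add: ennreal_mult' [symmetric])
    also have "\<dots> = ennreal (1 / w ?r) * (\<integral>\<^sup>+x. ennreal (G ?r x) \<partial>M)"
      by (intro nn_integral_cmult) measurable
    also have "\<dots> \<le> ennreal (1 / w ?r) * ennreal (C * real ?r * 2 ^ ?r)"
      by (intro mult_left_mono G_int) auto
    also have "\<dots> = ennreal (1 / w ?r * (C * real ?r * 2 ^ ?r))"
      using w_pos[of ?r] by (intro ennreal_mult' [symmetric]) simp
    also have "1 / w ?r * (C * real ?r * 2 ^ ?r)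
        = C * (real ?r powr 1 * real ?r powr (-(2 + 2 * \<epsilon>)))"
      unfolding w_def powr_minus by (simp add: divide_simps)
    also have "real ?r powr 1 * real ?r powr (-(2 + 2 * \<epsilon>)) = real ?r powr (-1 - 2 * \<epsilon>)"
      unfolding powr_add[symmetric] by simp
    finally show "(\<integral>\<^sup>+x. ennreal (G ?r x / w ?r) \<partial>M)
      \<le> ennreal (C * real ?r powr (-1 - 2 * \<epsilon>))" .
  qed
  also have "\<dots> = ennreal (\<Sum>r. C * real (Suc r) powr (-1 - 2 * \<epsilon>))"
  proof (rule suminf_ennreal2)
    have "summable (\<lambda>r. real r powr (-1 - 2 * \<epsilon>))"
      using \<open>\<epsilon> > 0\<close> by (simp add: summable_real_powr_iff)
    then show "summable (\<lambda>r. C * real (Suc r) powr (-1 - 2 * \<epsilon>))"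
      by (intro summable_mult) (subst summable_Suc_iff)
  qed (use \<open>C \<ge> 0\<close> in auto)
  finally have "(\<integral>\<^sup>+x. (\<Sum>r. ennreal (G (Suc r) x / w (Suc r))) \<partial>M) \<noteq> \<infinity>"
    by (auto simp: top_unique)
  then have "AE x in M. (\<Sum>r. ennreal (G (Suc r) x / w (Suc r))) \<noteq> \<infinity>"
    by (intro nn_integral_PInf_AE) measurable
  then show ?thesis
  proof (rule AE_mp, intro AE_I2 impI)
    fix x
    assume fin: "(\<Sum>r. ennreal (G (Suc r) x / w (Suc r))) \<noteq> \<infinity>"
    define H where "H = enn2real (\<Sum>r. ennreal (G (Suc r) x / w (Suc r)))"
    have G_le: "G r x \<le> H * w r" if r: "r \<ge> 1" for r
    proof -
      obtain k where k: "r = Suc k" using r by (cases r) auto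
      have "ennreal (G (Suc k) x / w (Suc k)) \<le> (\<Sum>r. ennreal (G (Suc r) x / w (Suc r)))"
        using sum_le_suminf[of "\<lambda>r. ennreal (G (Suc r) x / w (Suc r))" "{k}"] by simp
      then have "enn2real (ennreal (G r x / w r)) \<le> H"
        unfolding H_def k using fin by (intro enn2real_mono) (auto simp: less_top)
      then have "G r x / w r \<le> H"
        using w_pos[OF r] dyadic_energy_nonneg by (simp add: G_def less_imp_le)
      then show ?thesis using w_pos[OF r] by (simp add: divide_simps)
    qed
    have "H \<ge> 0" by (simp add: H_def)
    \<comment> \<open>The factors 4 come from \<open>2 ^ r \<le> 4 * t\<close> and
      \<open>r \<le> 4 * max 1 (ln t)\<close>.\<close>
    define K where "K = sqrt (H * 4 * 4 powr (3 + 2 * \<epsilon>))"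
    show "\<exists>K. \<forall>t\<ge>1. \<forall>j. real j \<le> 2 * t \<longrightarrow>
      \<bar>Z j x\<bar> \<le> K * error_rate \<epsilon> t"
    proof (intro exI[of _ K] allI impI)
      fix t :: real and j :: nat
      assume t: "1 \<le> t" and j: "real j \<le> 2 * t"
      obtain r where r: "r \<ge> 1" "2 * t < 2 ^ r" "2 ^ r \<le> 4 * t" "real r \<le> 4 * max 1 (ln t)"
        using exists_dyadic_level[OF t] .
      let ?L = "max 1 (ln t)"
      have "real j < 2 ^ r" using j r(2) by linarith
      then have "j < 2 ^ r" by (simp only: of_nat_less_numeral_power_cancel_iff)
      then have "(Z j x)\<^sup>2 \<le> real r * G r x"
        unfolding G_def by (intro square_le_dyadic_energy) (auto simp: zero)
      also have "\<dots> \<le> real r * (H * w r)"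
        using G_le[OF r(1)] by (intro mult_left_mono) auto
      also have "\<dots> = H * 2 ^ r * (real r powr 1 * real r powr (2 + 2 * \<epsilon>))"
        using r(1) by (simp add: w_def)
      also have "\<dots> = H * 2 ^ r * real r powr (3 + 2 * \<epsilon>)"
        unfolding powr_add[symmetric] by simp
      also have "\<dots> \<le> H * (4 * t) * (4 * ?L) powr (3 + 2 * \<epsilon>)"
        using r \<open>H \<ge> 0\<close> \<open>\<epsilon> > 0\<close> t by (intro mult_mono powr_mono2) auto
      also have "\<dots> = (H * 4 * 4 powr (3 + 2 * \<epsilon>)) * (t * ?L powr (3 + 2 * \<epsilon>))"
        by (simp add: powr_mult)
      finally have "sqrt ((Z j x)\<^sup>2) \<le> K * sqrt (t * ?L powr (3 + 2 * \<epsilon>))"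
        unfolding K_def real_sqrt_mult[symmetric] by (rule real_sqrt_le_mono)
      moreover have "sqrt (t * ?L powr (3 + 2 * \<epsilon>)) = t powr (1/2) * ?L powr (3/2 + \<epsilon>)"
        using t by (simp add: real_sqrt_mult powr_half_sqrt[symmetric] powr_powr add_divide_distrib)
      ultimately show "\<bar>Z j x\<bar> \<le> K * error_rate \<epsilon> t"
        by (simp add: error_rate_def)
    qed
  qed
qed

section \<open>Almost sure bounds for the count at all times\<close>

text \<open>By Borel--Cantelli almost every point lies in finitely many \<open>A n\<close> only, so
  the count and its mean both stay bounded; the rate is at least 1, so a constant absorbs
  them.\<close>

lemma (in prob_space) AE_count_bound_bounded:
  fixes A :: "nat \<Rightarrow> 'a set"
  assumes A: "\<And>n. n \<ge> 1 \<Longrightarrow> A n \<in> events"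
    and bounded: "\<And>N. (\<Sum>n=1..N. prob (A n)) \<le> B"
    and "\<epsilon> > 0"
  shows "AE x in M. \<exists>K. \<forall>N. \<bar>\<Sum>n=1..N. indicator (A n) x - prob (A n)\<bar>
    \<le> K * error_rate \<epsilon> (max 1 (\<Sum>n=1..N. prob (A n)))"
proof -
  have "summable (\<lambda>n. prob (A (Suc n)))"
  proof (rule bounded_imp_summable)
    fix N
    have "(\<Sum>n\<le>N. prob (A (Suc n))) = (\<Sum>n=1..Suc N. prob (A n))"
      by (simp add: sum.shift_bounds_cl_Suc_ivl atMost_atLeast0 del: sum.cl_ivl_Suc)
    then show "(\<Sum>n\<le>N. prob (A (Suc n))) \<le> B" using bounded[of "Suc N"] by simp
  qed simp
  then have "AE x in M. eventually (\<lambda>n. x \<in> space M - A (Suc n)) sequentially"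
    using A by (intro borel_cantelli_AE1) (auto simp: emeasure_eq_measure)
  then show ?thesis
  proof (rule AE_mp, intro AE_I2 impI)
    fix x assume "eventually (\<lambda>n. x \<in> space M - A (Suc n)) sequentially"
    then obtain n0 where n0: "x \<notin> A (Suc n)" if "n \<ge> n0" for n
      by (auto simp: eventually_sequentially)
    have miss: "indicator (A n) x = (0::real)" if "n > n0" for n
      using n0[of "n - 1"] that by (cases n) auto
    show "\<exists>K. \<forall>N. \<bar>\<Sum>n=1..N. indicator (A n) x - prob (A n)\<bar>
      \<le> K * error_rate \<epsilon> (max 1 (\<Sum>n=1..N. prob (A n)))"
    proof (intro exI[of _ "real n0 + B"] allI)
      fix N
      have "(\<Sum>n=1..N. indicator (A n) x) \<le> (\<Sum>n=1..N. if n \<le> n0 then 1 else (0::real))"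
        using miss by (intro sum_mono) (simp add: indicator_def not_le)
      also have "\<dots> = real (card ({1..N} \<inter> {n. n \<le> n0}))"
        by (subst sum.If_cases) auto
      also have "card ({1..N} \<inter> {n. n \<le> n0}) \<le> card {1..n0}"
        by (intro card_mono) auto
      finally have hits: "(\<Sum>n=1..N. indicator (A n) x) \<le> real n0" by simp
      have "0 \<le> (\<Sum>n=1..N. indicator (A n) x :: real)" "0 \<le> (\<Sum>n=1..N. prob (A n))"
        by (auto intro!: sum_nonneg)
      with hits bounded[of N]
      have "\<bar>\<Sum>n=1..N. indicator (A n) x - prob (A n)\<bar> \<le> real n0 + B"
        unfolding sum_subtractf by linarith
      also have "\<dots> = (real n0 + B) * 1" by simp
      also have "\<dots> \<le> (real n0 + B) * error_rate \<epsilon> (max 1 (\<Sum>n=1..N. prob (A n)))"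
        \<comment> \<open>The empty sum at \<open>N = 0\<close> shows
          \<open>B \<ge> 0\<close>.\<close>
        using bounded[of 0] \<open>\<epsilon> > 0\<close> by (intro mult_left_mono error_rate_ge_1) auto
      finally show "\<bar>\<Sum>n=1..N. indicator (A n) x - prob (A n)\<bar>
        \<le> (real n0 + B) * error_rate \<epsilon> (max 1 (\<Sum>n=1..N. prob (A n)))" .
    qed
  qed
qed

lemma (in prob_space) AE_count_bound_unbounded:
  fixes A :: "nat \<Rightarrow> 'a set" and \<phi> :: "nat \<Rightarrow> real"
  assumes A: "\<And>n. n \<ge> 1 \<Longrightarrow> A n \<in> events"
    and \<phi>: "summable \<phi>" "\<And>k. \<phi> k \<ge> 0"
    and cov: "\<And>m n. 1 \<le> m \<Longrightarrow> m < n \<Longrightarrow>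
      prob (A m \<inter> A n) \<le> prob (A m) * prob (A n) + \<phi> (n - m) * prob (A n)"
    and unbounded: "\<And>B. \<exists>N. (\<Sum>n=1..N. prob (A n)) > B"
    and "\<epsilon> > 0"
  shows "AE x in M. \<exists>K. \<forall>N. \<bar>\<Sum>n=1..N. indicator (A n) x - prob (A n)\<bar>
    \<le> K * error_rate \<epsilon> (max 1 (\<Sum>n=1..N. prob (A n)))"
proof -
  define \<Phi> where "\<Phi> N = (\<Sum>n=1..N. prob (A n))" for N
  define R where "R x N = (\<Sum>n=1..N. indicator (A n) x :: real)" for x N
  define D where "D x N = (\<Sum>n=1..N. indicator (A n) x - prob (A n))" for x N
  have D: "D x N = R x N - \<Phi> N" for x N
    by (simp add: D_def R_def \<Phi>_def sum_subtractf)
  have \<Phi>_mono: "\<Phi> a \<le> \<Phi> b" and R_mono: "R x a \<le> R x b" if "a \<le> b" for a b x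
    using that unfolding \<Phi>_def R_def by (auto intro!: sum_mono2)
  have \<Phi>_nonneg: "\<Phi> N \<ge> 0" for N by (simp add: \<Phi>_def sum_nonneg)
  define q where "q j = (LEAST N. real j \<le> \<Phi> N)" for j
  have q_ge: "real j \<le> \<Phi> (q j)" for j
    unfolding q_def
    by (rule LeastI_ex) (use unbounded[of "real j"] in \<open>auto simp: \<Phi>_def intro: less_imp_le\<close>)
  have q_least: "\<Phi> N < real j" if "N < q j" for N j
    using not_less_Least[of N "\<lambda>N. real j \<le> \<Phi> N"] that by (simp add: q_def not_le)
  have q_0: "q 0 = 0" unfolding q_def by (rule Least_eq_0) (simp add: \<Phi>_nonneg)
  \<comment> \<open>A single event has probability at most 1, so the threshold \<open>j\<close> is
    overshot by at most 1.\<close>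
  have q_lt: "\<Phi> (q j) \<le> real j + 1" for j
  proof (cases "q j")
    case 0
    then show ?thesis by (simp add: \<Phi>_def)
  next
    case (Suc N)
    then have "\<Phi> (q j) = \<Phi> N + prob (A (q j))" by (simp add: \<Phi>_def)
    then show ?thesis using q_least[of N j] prob_le_1[of "A (q j)"] Suc by linarith
  qed
  have q_mono: "q a \<le> q b" if "a \<le> b" for a b
    using q_least[of "q b" a] q_ge[of b] that by fastforce
  define V where "V = 1 + 2 * suminf \<phi>"
  have "V \<ge> 0" using suminf_nonneg[OF \<phi>] by (simp add: V_def)
  have "AE x in M. \<exists>K. \<forall>t\<ge>1. \<forall>j. real j \<le> 2 * t \<longrightarrow> \<bar>D x (q j)\<bar> \<le> K * error_rate \<epsilon> t"
  proof (rule AE_bound_of_linear_second_moment)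
    show "(\<lambda>x. D x (q j)) \<in> borel_measurable M" for j
      unfolding D_def using A by (intro borel_measurable_sum) auto
    show "D x (q 0) = 0" for x by (simp add: q_0 D_def)
    fix a b :: nat assume "a \<le> b"
    show "(\<integral>\<^sup>+x. ennreal ((D x (q b) - D x (q a))\<^sup>2) \<partial>M) \<le> ennreal (2 * V * (real b - real a))"
    proof (cases "a = b")
      case False
      let ?I = "{Suc (q a)..q b}"
      have split: "(\<Sum>n=1..q b. f n) - (\<Sum>n=1..q a. f n) = sum f ?I" for f :: "nat \<Rightarrow> real"
        using sum.ub_add_nat[of 1 "q a" f "q b - q a"] q_mono[OF \<open>a \<le> b\<close>] by simp
      have "(\<integral>\<^sup>+x. ennreal ((D x (q b) - D x (q a))\<^sup>2) \<partial>M)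
        \<le> ennreal (V * (\<Sum>n\<in>?I. prob (A n)))"
        unfolding D_def split V_def
        by (rule second_moment_centered_count) (use A \<phi> cov in auto)
      also have "(\<Sum>n\<in>?I. prob (A n)) = \<Phi> (q b) - \<Phi> (q a)"
        unfolding \<Phi>_def split ..
      \<comment> \<open>The increment of \<open>\<Phi>\<close> is at most \<open>b + 1 - a\<close>,
        and \<open>1 \<le> b - a\<close> for distinct integers turns this into
        \<open>2 * (b - a)\<close>.\<close>
      also have "V * (\<Phi> (q b) - \<Phi> (q a)) \<le> V * (2 * (real b - real a))"
        using q_ge[of a] q_lt[of b] False \<open>a \<le> b\<close> \<open>V \<ge> 0\<close> by (intro mult_left_mono) auto
      finally show ?thesis by (simp add: ennreal_leI mult_ac)
    qed simp
  qed (use \<open>V \<ge> 0\<close> \<open>\<epsilon> > 0\<close> in auto)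
  then show ?thesis
  proof (rule AE_mp, intro AE_I2 impI)
    fix x
    assume "\<exists>K. \<forall>t\<ge>1. \<forall>j. real j \<le> 2 * t \<longrightarrow> \<bar>D x (q j)\<bar> \<le> K * error_rate \<epsilon> t"
    then obtain K where
      K: "\<bar>D x (q j)\<bar> \<le> K * error_rate \<epsilon> t" if "t \<ge> 1" "real j \<le> 2 * t" for t j
      by blast
    have "\<bar>D x N\<bar> \<le> (K + 2) * error_rate \<epsilon> (max 1 (\<Phi> N))" for N
    proof -
      define j where "j = nat \<lfloor>\<Phi> N\<rfloor>"
      have j: "real j \<le> \<Phi> N" "\<Phi> N < real (Suc j)"
        using of_nat_nat[of "\<lfloor>\<Phi> N\<rfloor>"] \<Phi>_nonneg[of N] unfolding j_def by linarith+
      have "q j \<le> N" "N \<le> q (Suc j)"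
        using q_least[of N j] \<Phi>_mono[of "q (Suc j)" N] q_ge[of "Suc j"] j
        by (meson not_le le_cases order_trans)+
      then have "R x (q j) \<le> R x N" "R x N \<le> R x (q (Suc j))"
        by (auto intro: R_mono)
      \<comment> \<open>Over the sandwich \<open>q j \<le> N \<le> q (Suc j)\<close> the sum
        \<open>\<Phi>\<close> rises by at most 2, from at least \<open>j\<close> to at most
        \<open>j + 2\<close>.\<close>
      then have "\<bar>D x N\<bar> \<le> max \<bar>D x (q j)\<bar> \<bar>D x (q (Suc j))\<bar> + 2"
        using j q_ge[of j] q_lt[of "Suc j"] unfolding D by simp
      \<comment> \<open>Here the slack in \<open>K\<close> is used: both \<open>j\<close> and
        \<open>Suc j\<close> are at most \<open>2 * max 1 (\<Phi> N)\<close>.\<close>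
      moreover have "\<bar>D x (q j)\<bar> \<le> K * error_rate \<epsilon> (max 1 (\<Phi> N))"
        "\<bar>D x (q (Suc j))\<bar> \<le> K * error_rate \<epsilon> (max 1 (\<Phi> N))"
        using j by (auto intro!: K)
      moreover have "1 \<le> error_rate \<epsilon> (max 1 (\<Phi> N))"
        using \<open>\<epsilon> > 0\<close> by (intro error_rate_ge_1) auto
      ultimately show ?thesis unfolding distrib_right by linarith
    qed
    then show "\<exists>K. \<forall>N. \<bar>\<Sum>n=1..N. indicator (A n) x - prob (A n)\<bar>
      \<le> K * error_rate \<epsilon> (max 1 (\<Sum>n=1..N. prob (A n)))"
      unfolding D_def \<Phi>_def by blast
  qed
qed

text \<open>Removes \<open>max 1\<close> from the two cases. While \<open>\<Phi> N = 0\<close> the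
  rate is 0, so the count must vanish exactly, which holds off a null set; afterwards
  \<open>\<Phi>\<close> stays above its first positive value.\<close>

lemma (in prob_space) AE_count_asymptotics:
  fixes A :: "nat \<Rightarrow> 'a set" and \<phi> :: "nat \<Rightarrow> real"
  assumes A: "\<And>n. n \<ge> 1 \<Longrightarrow> A n \<in> events"
    and \<phi>: "summable \<phi>" "\<And>k. \<phi> k \<ge> 0"
    and cov: "\<And>m n. 1 \<le> m \<Longrightarrow> m < n \<Longrightarrow>
      prob (A m \<inter> A n) \<le> prob (A m) * prob (A n) + \<phi> (n - m) * prob (A n)"
    and "\<epsilon> > 0"
  shows "AE x in M. \<exists>K. \<forall>N. \<bar>\<Sum>n=1..N. indicator (A n) x - prob (A n)\<bar>
    \<le> K * error_rate \<epsilon> (\<Sum>n=1..N. prob (A n))"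
proof -
  define \<Phi> where "\<Phi> N = (\<Sum>n=1..N. prob (A n))" for N
  have \<Phi>_nonneg: "\<Phi> N \<ge> 0" for N by (simp add: \<Phi>_def sum_nonneg)
  have null: "AE x in M. \<forall>n. n \<ge> 1 \<longrightarrow> prob (A n) = 0 \<longrightarrow> x \<notin> A n"
    unfolding AE_all_countable
  proof
    fix n
    show "AE x in M. n \<ge> 1 \<longrightarrow> prob (A n) = 0 \<longrightarrow> x \<notin> A n"
      using A[of n] AE_not_in[of "A n" M]
      by (cases "n \<ge> 1 \<and> prob (A n) = 0") (auto simp: null_sets_def emeasure_eq_measure)
  qed
  have "AE x in M. \<exists>K. \<forall>N. \<bar>\<Sum>n=1..N. indicator (A n) x - prob (A n)\<bar>
    \<le> K * error_rate \<epsilon> (max 1 (\<Phi> N))"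
  proof (cases "\<exists>B. \<forall>N. \<Phi> N \<le> B")
    case True
    then show ?thesis using AE_count_bound_bounded[of A] A \<open>\<epsilon> > 0\<close> unfolding \<Phi>_def by blast
  next
    case False
    then show ?thesis
      using AE_count_bound_unbounded[of A \<phi> \<epsilon>, OF A \<phi> cov] \<open>\<epsilon> > 0\<close>
      unfolding \<Phi>_def not_ex not_all not_le by blast
  qed
  with null show ?thesis
  proof eventually_elim
    case (elim x)
    define D where "D N = (\<Sum>n=1..N. indicator (A n) x - prob (A n))" for N
    obtain K where "\<And>N. \<bar>D N\<bar> \<le> K * error_rate \<epsilon> (max 1 (\<Phi> N))"
      using elim(2) unfolding D_def by blast
    moreover have "error_rate \<epsilon> t \<ge> 0" for t by (simp add: error_rate_def)
    ultimately have K: "\<bar>D N\<bar> \<le> \<bar>K\<bar> * error_rate \<epsilon> (max 1 (\<Phi> N))" for N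
      by (meson abs_ge_self mult_right_mono order_trans)
    have D_zero: "D N = 0" if "\<Phi> N = 0" for N
    proof -
      have "prob (A n) = 0" if "n \<in> {1..N}" for n
        using \<open>\<Phi> N = 0\<close> that unfolding \<Phi>_def by (subst (asm) sum_nonneg_eq_0_iff) auto
      then show ?thesis using elim(1) by (auto simp: D_def indicator_def intro!: sum.neutral)
    qed
    \<comment> \<open>If \<open>\<Phi>\<close> is never positive, \<open>\<delta>\<close> is
      unspecified, but then every \<open>N\<close> falls under \<open>D_zero\<close>.\<close>
    define \<delta> where "\<delta> = \<Phi> (LEAST N. \<Phi> N > 0)"
    have \<delta>: "0 < \<delta> \<and> \<delta> \<le> \<Phi> N" if "\<Phi> N > 0" for N
    proof
      show "0 < \<delta>" unfolding \<delta>_def using that by (rule LeastI)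
      have "(LEAST N. \<Phi> N > 0) \<le> N" using that by (rule Least_le)
      then show "\<delta> \<le> \<Phi> N" unfolding \<delta>_def \<Phi>_def by (auto intro!: sum_mono2)
    qed
    have "\<bar>D N\<bar> \<le> (\<bar>K\<bar> * max 1 (\<delta> powr (-1/2))) * error_rate \<epsilon> (\<Phi> N)" for N
    proof (cases "\<Phi> N = 0")
      case True
      then show ?thesis using D_zero[of N] by (simp add: error_rate_def)
    next
      case False
      then have "\<Phi> N > 0" using \<Phi>_nonneg[of N] by simp
      note \<delta>[OF this]
      then have "\<bar>K\<bar> * error_rate \<epsilon> (max 1 (\<Phi> N))
        \<le> \<bar>K\<bar> * (max 1 (\<delta> powr (-1/2)) * error_rate \<epsilon> (\<Phi> N))"
        by (intro mult_left_mono error_rate_max_1_le) auto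
      with K[of N] show ?thesis by (simp add: mult.assoc)
    qed
    then show ?case unfolding D_def \<Phi>_def by blast
  qed
qed

section \<open>Application to measure-preserving systems\<close>

context measure_preserving_system
begin

lemma funpow_measurable: "T ^^ n \<in> measurable M M"
  by (induction n) (simp_all only: funpow.simps measurable_ident measurable_comp[OF _ T_measurable])

lemma prob_funpow_vimage:
  assumes "A \<in> events"
  shows "prob ((T ^^ n) -` A \<inter> space M) = prob A"
proof (induction n)
  case 0
  then show ?case using sets.sets_into_space[OF assms] by (simp add: Int_absorb2)
next
  case (Suc n)
  let ?B = "(T ^^ n) -` A \<inter> space M"
  have "(T ^^ Suc n) -` A \<inter> space M = T -` ?B \<inter> space M"
    using measurable_space[OF T_measurable] by (auto simp: funpow_swap1)
  moreover have "?B \<in> events" using funpow_measurable assms by (rule measurable_sets)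
  ultimately have "prob ((T ^^ Suc n) -` A \<inter> space M) = prob ?B"
    using T_preserves[of ?B] by (simp only: measure_def)
  then show ?case using Suc by (simp only:)
qed

text \<open>For \<open>prob F > 0\<close> this is the mixing bound multiplied by
  \<open>prob F\<close>. Null sets \<open>F\<close> do not enter the supremum, but their preimages
  are null by invariance.\<close>

lemma prob_Int_funpow_le:
  assumes "\<C> \<subseteq> events" "E \<in> \<C>" "F \<in> \<C>" "mixing_coeff M T \<C> n < \<infinity>"
  shows "prob (E \<inter> ((T ^^ n) -` F \<inter> space M))
    \<le> prob E * prob F + enn2real (mixing_coeff M T \<C> n) * prob F"
proof (cases "prob F > 0")
  case True
  let ?u = "prob (E \<inter> ((T ^^ n) -` F \<inter> space M)) / prob F"
  have "ennreal \<bar>?u - prob E\<bar> \<le> mixing_coeff M T \<C> n"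
    unfolding mixing_coeff_def using assms True by (intro Sup_upper) blast
  then have "\<bar>?u - prob E\<bar> \<le> enn2real (mixing_coeff M T \<C> n)"
    using enn2real_mono[OF _ assms(4)[unfolded infinity_ennreal_def]] by fastforce
  then have "?u \<le> prob E + enn2real (mixing_coeff M T \<C> n)" by linarith
  then show ?thesis using True by (simp add: divide_le_eq distrib_right)
next
  case False
  have F: "F \<in> events" using assms by auto
  have "prob (E \<inter> ((T ^^ n) -` F \<inter> space M)) \<le> prob ((T ^^ n) -` F \<inter> space M)"
    using measurable_sets[OF funpow_measurable F] by (intro finite_measure_mono) auto
  then show ?thesis
    using False prob_funpow_vimage[OF F, of n] by (simp add: zero_less_measure_iff)
qed

lemma AE_hit_count_asymptotics:
  assumes C: "\<C> \<subseteq> events" and mixing: "summable_mixing M T \<C>"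
    and E: "\<And>n. n \<ge> 1 \<Longrightarrow> E n \<in> \<C>" and "\<epsilon> > 0"
  shows "AE x in M. \<exists>K. \<forall>N\<ge>1. \<bar>real (hit_count T E x N) - measure_sum M E N\<bar>
    \<le> K * error_rate \<epsilon> (measure_sum M E N)"
proof -
  define A where "A n = (T ^^ n) -` E n \<inter> space M" for n
  \<comment> \<open>\<open>enn2real\<close> sends an infinite value to 0. Mixing excludes this for
    \<open>k \<ge> 1\<close>, and only positive lags \<open>n - m\<close> occur below.\<close>
  define \<phi> where "\<phi> k = enn2real (mixing_coeff M T \<C> k)" for k
  have E_events: "E n \<in> events" if "n \<ge> 1" for n using that E C by auto
  have A_events: "A n \<in> events" if "n \<ge> 1" for n
    unfolding A_def using funpow_measurable E_events[OF that] by (rule measurable_sets)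
  have prob_A: "prob (A n) = prob (E n)" if "n \<ge> 1" for n
    unfolding A_def by (intro prob_funpow_vimage E_events that)
  have fin: "mixing_coeff M T \<C> (Suc k) < \<infinity>" for k
    using sum_le_suminf[of "\<lambda>n. mixing_coeff M T \<C> (Suc n)" "{k}"] mixing
    unfolding summable_mixing_def by (simp add: le_less_trans)
  have "summable (\<lambda>k. \<phi> (Suc k))"
  proof (rule summable_suminf_not_top)
    have "ennreal (\<phi> (Suc k)) = mixing_coeff M T \<C> (Suc k)" for k
      using fin[of k] by (simp add: \<phi>_def)
    then show "(\<Sum>k. ennreal (\<phi> (Suc k))) \<noteq> top"
      using mixing by (simp add: summable_mixing_def)
  qed (simp add: \<phi>_def)
  then have \<phi>: "summable \<phi>" by (simp only: summable_Suc_iff)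
  have cov: "prob (A m \<inter> A n) \<le> prob (A m) * prob (A n) + \<phi> (n - m) * prob (A n)"
    if "1 \<le> m" "m < n" for m n
  proof -
    let ?G = "E m \<inter> ((T ^^ (n - m)) -` E n \<inter> space M)"
    have "(T ^^ n) x = (T ^^ (n - m)) ((T ^^ m) x)" for x
      using that by (metis comp_apply funpow_add le_add_diff_inverse2 less_imp_le)
    \<comment> \<open>Pulling out the common factor \<open>T ^^ m\<close> lets invariance remove it,
      so only the lag \<open>n - m\<close> remains.\<close>
    then have "A m \<inter> A n = (T ^^ m) -` ?G \<inter> space M"
      using measurable_space[OF funpow_measurable[of m]] by (auto simp: A_def)
    moreover have "?G \<in> events"
      using that E_events by (intro sets.Int measurable_sets[OF funpow_measurable]) auto
    ultimately have "prob (A m \<inter> A n) = prob ?G" by (simp only: prob_funpow_vimage)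
    also have "\<dots> \<le> prob (E m) * prob (E n) + \<phi> (n - m) * prob (E n)"
      unfolding \<phi>_def using that E C fin[of "n - m - 1"] Suc_diff_1[of "n - m"]
      by (intro prob_Int_funpow_le) auto
    finally show ?thesis using that by (simp add: prob_A)
  qed
  have "AE x in M. \<exists>K. \<forall>N. \<bar>\<Sum>n=1..N. indicator (A n) x - prob (A n)\<bar>
    \<le> K * error_rate \<epsilon> (\<Sum>n=1..N. prob (A n))"
    by (intro AE_count_asymptotics[where \<phi> = \<phi>])
      (use A_events \<phi> cov \<open>\<epsilon> > 0\<close> in \<open>auto simp: \<phi>_def\<close>)
  moreover have "(\<Sum>n=1..N. prob (A n)) = measure_sum M E N" for N
    unfolding measure_sum_def by (intro sum.cong) (auto simp: prob_A)
  moreover have "(\<Sum>n=1..N. indicator (A n) x) = real (hit_count T E x N)"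
    if "x \<in> space M" for x N
    using that by (simp add: hit_count_def A_def indicator_def sum.If_cases Int_def)
  ultimately show ?thesis
    by (elim AE_mp, intro AE_I2 impI) (simp add: sum_subtractf, blast)
qed

end

theorem theorem1:
  fixes M :: "'a measure" and T :: "'a \<Rightarrow> 'a" and \<C> :: "'a set set"
    and E :: "nat \<Rightarrow> 'a set" and \<epsilon> :: real
  assumes "measure_preserving_system M T"
    and "\<C> \<subseteq> sets M"
    and "summable_mixing M T \<C>"
    and "\<And>n. n \<ge> 1 \<Longrightarrow> E n \<in> \<C>"
    and "\<epsilon> > 0"
  shows "AE x in M. \<exists>K. \<forall>N\<ge>1.
           \<bar>real (hit_count T E x N) - measure_sum M E N\<bar>
             \<le> K * (measure_sum M E N powr (1/2)
                    * max 1 (ln (measure_sum M E N)) powr (3/2 + \<epsilon>))"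
  using measure_preserving_system.AE_hit_count_asymptotics[OF assms]
  unfolding error_rate_def .

end
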